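(* For each $n\ge 1$, place at every one of the $2^n$ vertices of the cube $[-1,1]^n\subset\mathbb{R}^n$ (i.e. at every point of $\{-1,1\}^n$) an $n$-dimensional ball of radius $r_n$ centered at that vertex. Let $p(r_n)$ be the probability that a random line through the origin in $\mathbb{R}^n$ intersects at least one of these $2^n$ balls. Then the following hold. 1. If $r_n\le\sqrt{\alpha n}$ for all $n$, where $\alpha<1-2/\pi$ is a constant, then $p(r_n)\to 0$ as $n\to\infty$. 2. If $r_n\ge\sqrt{\alpha n}$ for all $n$, where $\alpha>1-2/\pi$ is a constant, then $p(r_n)\to 1$ as $n\to\infty$. 3. If $r_n=\sqrt{(1-2/\pi)n}+z\sqrt{\frac{2(\pi-3)}{\pi(\pi-2)}}$, where $z\in\mathbb{R}$ is a constant, then $p(r_n)\to\Phi(z)$ as $n\to\infty$, where $\Phi$ is the cumulative distribution function of the standard normal distribution.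
   Context: A random line in $\mathbb{R}^n$ is the line $\{\mathbf{Y}t : t\in\mathbb{R}\}$ through the origin, where $\mathbf{Y}=(Y_1,\dots,Y_n)$ is a vector of independent identically distributed standard normal random variables. The ball of radius $r$ centered at $\mathbf{v}$ is $\{\mathbf{x}\in\mathbb{R}^n:\|\mathbf{x}-\mathbf{v}\|\le r\}$ with the Euclidean norm. Radii are nonnegative (so $\alpha\ge 0$ is implicit in part 1, and in part 3 only those $n$ for which the formula gives $r_n\ge 0$, which includes all sufficiently large $n$, are considered). *)

theory Defs
  imports "HOL-Probability.Probability"
begin

text \<open>
  Since the dimension varies, a vector of \<open>n\<close>-dimensional real space is represented by an
  extensional function on the index set \<open>{..<n}\<close>; this is also the carrier of the product
  measure \<^term>\<open>\<Pi>\<^sub>M i\<in>{..<n}. std_normal_distribution\<close>. \<^const>\<open>L2_set\<close> is the Euclidean norm.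
\<close>

definition Rn :: "nat \<Rightarrow> (nat \<Rightarrow> real) set" where
  "Rn n = {..<n} \<rightarrow>\<^sub>E UNIV"

definition ball_Rn :: "nat \<Rightarrow> (nat \<Rightarrow> real) \<Rightarrow> real \<Rightarrow> (nat \<Rightarrow> real) set" where
  "ball_Rn n v r = {x \<in> Rn n. L2_set (\<lambda>i. x i - v i) {..<n} \<le> r}"

definition line_Rn :: "nat \<Rightarrow> (nat \<Rightarrow> real) \<Rightarrow> (nat \<Rightarrow> real) set" where
  "line_Rn n y = range (\<lambda>t::real. \<lambda>i\<in>{..<n}. y i * t)"

definition cube_vertices :: "nat \<Rightarrow> (nat \<Rightarrow> real) set" where
  "cube_vertices n = {..<n} \<rightarrow>\<^sub>E {-1, 1}"

definition gauss_vec :: "nat \<Rightarrow> (nat \<Rightarrow> real) measure" where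
  "gauss_vec n = (\<Pi>\<^sub>M i\<in>{..<n}. std_normal_distribution)"

definition hit_prob :: "nat \<Rightarrow> real \<Rightarrow> real" where
  "hit_prob n r =
     \<P>(y in gauss_vec n. \<exists>v\<in>cube_vertices n. line_Rn n y \<inter> ball_Rn n v r \<noteq> {})"

text \<open>The hitting event is measurable, so \<^const>\<open>hit_prob\<close> is a genuine probability.\<close>

lemma prob_space_gauss_vec: "prob_space (gauss_vec n)"
  unfolding gauss_vec_def
  by (intro prob_space_PiM real_distribution.axioms(1) real_dist_normal_dist)

lemma line_hits_ball_iff:
  "line_Rn n y \<inter> ball_Rn n v r \<noteq> {} \<longleftrightarrow>
     L2_set (\<lambda>i. y i * ((\<Sum>i<n. y i * v i) / (\<Sum>i<n. (y i)\<^sup>2)) - v i) {..<n} \<le> r"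
proof -
  define b where "b = (\<Sum>i<n. y i * v i)"
  define S where "S = (\<Sum>i<n. (y i)\<^sup>2)"
  define V where "V = (\<Sum>i<n. (v i)\<^sup>2)"
  have sq: "(\<Sum>i<n. (y i * t - v i)\<^sup>2) = t\<^sup>2 * S - 2 * t * b + V" for t
    unfolding S_def b_def V_def sum_distrib_left sum_subtractf[symmetric] sum.distrib[symmetric]
    by (intro sum.cong refl) (simp add: power2_eq_square algebra_simps)
  have bS: "b / S * S = b"
  proof (cases "S = 0")
    case True
    then have "\<forall>i<n. y i = 0"
      unfolding S_def by (subst (asm) sum_nonneg_eq_0_iff) auto
    then show ?thesis by (simp add: b_def)
  qed simp
  have min: "L2_set (\<lambda>i. y i * (b / S) - v i) {..<n} \<le> L2_set (\<lambda>i. y i * t - v i) {..<n}" for t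
  proof -
    define u where "u = b / S"
    have "t\<^sup>2 * S - 2 * t * b + V - (u\<^sup>2 * S - 2 * u * b + V) = (t - u)\<^sup>2 * S"
      using bS unfolding u_def[symmetric] by (auto simp: power2_eq_square algebra_simps)
    moreover have "S \<ge> 0" unfolding S_def by (simp add: sum_nonneg)
    ultimately have "u\<^sup>2 * S - 2 * u * b + V \<le> t\<^sup>2 * S - 2 * t * b + V"
      by (smt (verit) mult_nonneg_nonneg zero_le_power2)
    then show ?thesis unfolding L2_set_def sq u_def by simp
  qed
  have "line_Rn n y \<inter> ball_Rn n v r \<noteq> {} \<longleftrightarrow> (\<exists>t. L2_set (\<lambda>i. y i * t - v i) {..<n} \<le> r)"
  proof -
    have "L2_set (\<lambda>i. (\<lambda>i\<in>{..<n}. y i * t) i - v i) {..<n} = L2_set (\<lambda>i. y i * t - v i) {..<n}" for t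
      by (intro L2_set_cong) auto
    moreover have "(\<lambda>i\<in>{..<n}. y i * t) \<in> Rn n" for t
      by (simp add: Rn_def)
    ultimately have in_ball: "(\<lambda>i\<in>{..<n}. y i * t) \<in> ball_Rn n v r \<longleftrightarrow>
        L2_set (\<lambda>i. y i * t - v i) {..<n} \<le> r" for t
      unfolding ball_Rn_def mem_Collect_eq by simp
    show ?thesis
      unfolding line_Rn_def in_ball[symmetric] by blast
  qed
  also have "\<dots> \<longleftrightarrow> L2_set (\<lambda>i. y i * (b / S) - v i) {..<n} \<le> r"
    using min order_trans by blast
  finally show ?thesis unfolding b_def S_def .
qed

lemma hit_event_measurable:
  "{y \<in> space (gauss_vec n). \<exists>v\<in>cube_vertices n. line_Rn n y \<inter> ball_Rn n v r \<noteq> {}}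
     \<in> sets (gauss_vec n)"
proof -
  have fin: "finite (cube_vertices n)"
    unfolding cube_vertices_def by (intro finite_PiE) auto
  have "(\<lambda>y. y i) \<in> borel_measurable (gauss_vec n)" if "i < n" for i
    unfolding gauss_vec_def using that
      measurable_component_singleton[of i "{..<n}" "\<lambda>_. std_normal_distribution"] by simp
  then have meas: "(\<lambda>y. y i) \<in> borel_measurable (gauss_vec n)" if "i \<in> {..<n}" for i
    using that by simp
  have "{y \<in> space (gauss_vec n).
      L2_set (\<lambda>i. y i * ((\<Sum>i<n. y i * v i) / (\<Sum>i<n. (y i)\<^sup>2)) - v i) {..<n} \<le> r}
      \<in> sets (gauss_vec n)" for v
    unfolding L2_set_def
    by (intro borel_measurable_le borel_measurable_const
        borel_measurable_sqrt[THEN measurable_compose[rotated]] borel_measurable_sum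
        borel_measurable_power borel_measurable_diff borel_measurable_times
        borel_measurable_divide meas)
  then show ?thesis
    unfolding line_hits_ball_iff by (intro sets.sets_Collect_finite_Ex fin)
qed

end

theory Submission
  imports Defs
begin

text \<open>
  Let \<open>B\<close> be the sum of the \<open>\<bar>y i\<bar>\<close> and \<open>S\<close> the sum of the \<open>y i\<^sup>2\<close>. The vertex nearest to the line
  spanned by \<open>y\<close> copies the signs of \<open>y\<close>, and its squared distance from the line is
  \<open>n - B\<^sup>2 / S\<close> (\<open>line_hits_cube_ball_iff\<close>). A ball of radius \<open>r\<close> is hit if and only if this is at
  most \<open>r\<^sup>2\<close>. By the law of large numbers \<open>B\<close> is about \<open>n sqrt (2 / pi)\<close> and \<open>S\<close> is about \<open>n\<close>, so
  the critical value of \<open>r\<^sup>2\<close> is about \<open>(1 - 2 / pi) n\<close>.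

  At the critical radius the condition reads \<open>l sqrt (n S) \<le> B\<close>, where the slope \<open>l\<close> converges to
  \<open>c = sqrt (2 / pi)\<close> and the leading correction is \<open>- z sqrt (1 - 3 / pi) / sqrt n\<close>
  (\<open>critical_slope_rate\<close>). The geometric mean \<open>sqrt (n S)\<close> differs from the arithmetic mean
  \<open>(n + S) / 2\<close> by at most \<open>(S - n)\<^sup>2 / (2 n)\<close>, which is bounded in mean and hence negligible on the
  scale \<open>sqrt n\<close> of the fluctuations (\<open>linearisation_error\<close>). What remains is a sum of independent
  identically distributed centred variables \<open>c / 2 (Y\<^sup>2 + 1) - \<bar>Y\<bar>\<close> of variance \<open>1 - 3 / pi\<close>, and the
  one-dimensional central limit theorem applies (\<open>gauss_seq_contrast_clt\<close>). The errors are absorbed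
  by a form of Slutsky's theorem (\<open>tendsto_prob_add_negligible\<close>).

  The other two regimes follow from the critical one. The hitting probability is monotone in the
  radius, and \<open>sqrt (\<alpha> n)\<close> is eventually below (above) the critical radius for every \<open>z\<close> when \<open>\<alpha>\<close>
  is below (above) \<open>1 - 2 / pi\<close>. The limit is therefore bounded by \<open>\<Phi> z\<close> for every \<open>z\<close>, and
  \<open>\<Phi>\<close> tends to zero (one) at minus (plus) infinity.
\<close>

section \<open>Negligible perturbations and sums of independent variables\<close>

text \<open>
  The part of Slutsky's theorem about sums, for a limit law without atoms. If \<open>\<bar>R n\<bar> < h\<close> then
  \<open>X n \<le> x - h\<close> implies \<open>X n + R n \<le> x\<close>, which in turn implies \<open>X n \<le> x + h\<close>. The
  probability is therefore squeezed between two values of the distribution function of \<open>X n\<close>, up to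
  \<open>P(\<bar>R n\<bar> \<ge> h)\<close>, and continuity of the limiting distribution function lets \<open>h\<close> shrink.
\<close>

lemma (in prob_space) tendsto_prob_add_negligible:
  fixes X R :: "nat \<Rightarrow> 'a \<Rightarrow> real"
  assumes X [measurable]: "\<And>n. random_variable borel (X n)"
    and R [measurable]: "\<And>n. random_variable borel (R n)"
    and conv: "weak_conv_m (\<lambda>n. distr M borel (X n)) \<mu>"
    and cont: "\<And>x. isCont (cdf \<mu>) x"
    and negl: "\<And>e. e > 0 \<Longrightarrow> (\<lambda>n. prob {\<omega> \<in> space M. e \<le> \<bar>R n \<omega>\<bar>}) \<longlonglongrightarrow> 0"
  shows "(\<lambda>n. prob {\<omega> \<in> space M. X n \<omega> + R n \<omega> \<le> x}) \<longlonglongrightarrow> cdf \<mu> x"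
proof (rule LIMSEQ_I)
  fix e :: real
  assume e: "e > 0"
  define F where "F n y = prob {\<omega> \<in> space M. X n \<omega> \<le> y}" for n y
  have F_conv: "(\<lambda>n. F n y) \<longlonglongrightarrow> cdf \<mu> y" for y
  proof -
    have "cdf (distr M borel (X n)) y = F n y" for n
      unfolding cdf_def F_def
      by (subst measure_distr) (auto intro!: arg_cong[where f = prob])
    then show ?thesis
      using conv cont[of y] unfolding weak_conv_m_def weak_conv_def by auto
  qed
  obtain d where d: "d > 0" "\<And>y. \<bar>y - x\<bar> < d \<Longrightarrow> \<bar>cdf \<mu> y - cdf \<mu> x\<bar> < e / 3"
    using cont[of x] e unfolding continuous_at_eps_delta dist_real_def
    by (metis zero_less_divide_iff zero_less_numeral)
  define h where "h = d / 2"
  have h: "h > 0" "\<bar>cdf \<mu> (x + h) - cdf \<mu> x\<bar> < e / 3" "\<bar>cdf \<mu> (x - h) - cdf \<mu> x\<bar> < e / 3"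
    using d by (auto simp: h_def)
  define p where "p n = prob {\<omega> \<in> space M. h \<le> \<bar>R n \<omega>\<bar>}" for n
  have upper: "prob {\<omega> \<in> space M. X n \<omega> + R n \<omega> \<le> x} \<le> F n (x + h) + p n" for n
    unfolding F_def p_def
    by (rule order_trans[OF finite_measure_mono measure_Un_le]) auto
  have lower: "F n (x - h) \<le> prob {\<omega> \<in> space M. X n \<omega> + R n \<omega> \<le> x} + p n" for n
    unfolding F_def p_def
    by (rule order_trans[OF finite_measure_mono measure_Un_le]) auto
  have e3: "e / 3 > 0"
    using e by simp
  have "\<forall>\<^sub>F n in sequentially. \<bar>F n (x + h) - cdf \<mu> (x + h)\<bar> < e / 3"
    using tendstoD[OF F_conv e3] by (simp add: dist_real_def)
  moreover have "\<forall>\<^sub>F n in sequentially. \<bar>F n (x - h) - cdf \<mu> (x - h)\<bar> < e / 3"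
    using tendstoD[OF F_conv e3] by (simp add: dist_real_def)
  moreover have "\<forall>\<^sub>F n in sequentially. \<bar>p n\<bar> < e / 3"
    using tendstoD[OF negl[OF h(1)] e3] by (simp add: dist_real_def p_def)
  ultimately have "\<forall>\<^sub>F n in sequentially.
      norm (prob {\<omega> \<in> space M. X n \<omega> + R n \<omega> \<le> x} - cdf \<mu> x) < e"
  proof eventually_elim
    case (elim n)
    then show ?case
      using upper[of n] lower[of n] h unfolding real_norm_def by linarith
  qed
  then show "\<exists>no. \<forall>n\<ge>no. norm (prob {\<omega> \<in> space M. X n \<omega> + R n \<omega> \<le> x} - cdf \<mu> x) < e"
    unfolding eventually_sequentially .
qed

text \<open>
  Markov's inequality turns a deterministic null sequence \<open>\<delta>\<close> times a variable with bounded mean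
  into a sequence that tends to zero in probability. The linearisation error below comes in this form,
  with \<open>Q n\<close> a squared deviation from the mean.
\<close>

lemma (in prob_space) tendsto_prob_dominated_zero:
  fixes R Q :: "nat \<Rightarrow> 'a \<Rightarrow> real"
  assumes R [measurable]: "\<And>n. random_variable borel (R n)"
    and Q: "\<And>n. integrable M (Q n)" "\<And>n \<omega>. Q n \<omega> \<ge> 0" "\<And>n. expectation (Q n) \<le> K"
    and \<delta>: "\<delta> \<longlonglongrightarrow> 0" "\<And>n. \<delta> n \<ge> 0"
    and le: "\<forall>\<^sub>F n in sequentially. \<forall>\<omega>. \<bar>R n \<omega>\<bar> \<le> \<delta> n * (1 + Q n \<omega>)"
    and e: "e > 0"
  shows "(\<lambda>n. prob {\<omega> \<in> space M. e \<le> \<bar>R n \<omega>\<bar>}) \<longlonglongrightarrow> 0"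
proof (rule tendsto_sandwich[OF _ _ tendsto_const])
  show "(\<lambda>n. \<delta> n * (1 + K) / e) \<longlonglongrightarrow> 0"
    by (rule tendsto_eq_intros \<delta> refl)+ (use e in auto)
  show "\<forall>\<^sub>F n in sequentially. prob {\<omega> \<in> space M. e \<le> \<bar>R n \<omega>\<bar>} \<le> \<delta> n * (1 + K) / e"
    using le
  proof eventually_elim
    case (elim n)
    have [measurable]: "random_variable borel (Q n)"
      using Q(1) by blast
    have "prob {\<omega> \<in> space M. e \<le> \<bar>R n \<omega>\<bar>} \<le> prob {\<omega> \<in> space M. e \<le> \<delta> n * (1 + Q n \<omega>)}"
      by (rule finite_measure_mono) (use elim order_trans in auto)
    also have "\<dots> \<le> (\<integral>\<omega>. \<delta> n * (1 + Q n \<omega>) \<partial>M) / e"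
      by (rule integral_Markov_inequality_measure[where A = "space M"])
         (use Q \<delta> e in auto)
    also have "(\<integral>\<omega>. \<delta> n * (1 + Q n \<omega>) \<partial>M) = \<delta> n * (1 + expectation (Q n))"
      using Q(1) by (simp add: prob_space)
    also have "\<dots> / e \<le> \<delta> n * (1 + K) / e"
      using Q(3)[of n] \<delta>(2)[of n] e by (intro divide_right_mono mult_left_mono) auto
    finally show ?case .
  qed
qed auto

text \<open>
  Bienayme's identity for centred variables: the mixed terms vanish by independence.
\<close>

lemma (in prob_space) second_moment_sum_indep:
  fixes X :: "nat \<Rightarrow> 'a \<Rightarrow> real"
  assumes indep: "indep_vars (\<lambda>_. borel) X UNIV"
    and sq: "\<And>i. integrable M (\<lambda>\<omega>. (X i \<omega>)\<^sup>2)"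
    and mean: "\<And>i. expectation (X i) = 0"
    and var: "\<And>i. expectation (\<lambda>\<omega>. (X i \<omega>)\<^sup>2) = v"
  shows "integrable M (\<lambda>\<omega>. (\<Sum>i<n. X i \<omega>)\<^sup>2) \<and> expectation (\<lambda>\<omega>. (\<Sum>i<n. X i \<omega>)\<^sup>2) = real n * v"
proof (induction n)
  case 0
  then show ?case by simp
next
  case (Suc n)
  have X [measurable]: "random_variable borel (X i)" for i
    using indep unfolding indep_vars_def2 by simp
  have int: "integrable M (X i)" for i
    by (rule square_integrable_imp_integrable[OF X sq])
  have ind: "indep_var borel (X n) borel (\<lambda>\<omega>. \<Sum>i<n. X i \<omega>)"
    by (rule indep_vars_sum) (use indep_vars_subset[OF indep] in auto)
  have int_sum: "integrable M (\<lambda>\<omega>. \<Sum>i<n. X i \<omega>)"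
    using int by simp
  have prod: "integrable M (\<lambda>\<omega>. X n \<omega> * (\<Sum>i<n. X i \<omega>))"
      "expectation (\<lambda>\<omega>. X n \<omega> * (\<Sum>i<n. X i \<omega>)) = 0"
    using indep_var_integrable[OF ind int int_sum] indep_var_lebesgue_integral[OF ind int int_sum]
      mean by simp_all
  have eq: "(\<Sum>i<Suc n. X i \<omega>)\<^sup>2
      = (\<Sum>i<n. X i \<omega>)\<^sup>2 + (X n \<omega>)\<^sup>2 + 2 * (X n \<omega> * (\<Sum>i<n. X i \<omega>))" for \<omega>
    by (simp add: power2_eq_square algebra_simps)
  show ?case
    unfolding eq using Suc prod sq var by (simp add: algebra_simps)
qed

section \<open>An infinite sequence of independent standard normal variables\<close>

lemma isCont_cdf_std_normal: "isCont (cdf std_normal_distribution) x"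
proof -
  interpret real_distribution std_normal_distribution
    by (rule real_dist_normal_dist)
  have "emeasure std_normal_distribution {x} = 0"
    by (subst emeasure_density) (auto intro!: nn_integral_null_set)
  then show ?thesis
    unfolding isCont_cdf by (simp add: measure_def)
qed

text \<open>
  The vectors of different dimensions live on different spaces, while the central limit theorem needs
  one sequence of variables on a single space. Every finite-dimensional Gaussian vector is a projection
  of this infinite one.
\<close>

definition gauss_seq :: "(nat \<Rightarrow> real) measure" where
  "gauss_seq = (\<Pi>\<^sub>M i\<in>UNIV. std_normal_distribution)"

lemma product_prob_space_std_normal: "product_prob_space (\<lambda>_::nat. std_normal_distribution)"
  by (intro product_prob_spaceI real_distribution.axioms(1) real_dist_normal_dist)

lemma prob_space_gauss_seq: "prob_space gauss_seq"
  unfolding gauss_seq_def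
  by (intro prob_space_PiM real_distribution.axioms(1) real_dist_normal_dist)

lemma measurable_gauss_seq_component [measurable]: "(\<lambda>\<omega>. \<omega> i) \<in> borel_measurable gauss_seq"
  unfolding gauss_seq_def
  using measurable_component_singleton[of i UNIV "\<lambda>_. std_normal_distribution"] by simp

lemma distr_gauss_seq_component: "distr gauss_seq std_normal_distribution (\<lambda>\<omega>. \<omega> i) = std_normal_distribution"
  unfolding gauss_seq_def
  by (rule distr_PiM_component) (auto intro: real_distribution.axioms(1) real_dist_normal_dist)

lemma indep_vars_gauss_seq: "prob_space.indep_vars gauss_seq (\<lambda>_. borel) (\<lambda>i \<omega>. f (\<omega> i)) UNIV"
  if [measurable]: "f \<in> borel_measurable borel" for f :: "real \<Rightarrow> real"
proof -
  interpret prob_space gauss_seq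
    by (rule prob_space_gauss_seq)
  have *: "distr gauss_seq borel (\<lambda>\<omega>. \<omega> i) = std_normal_distribution" for i
    using distr_gauss_seq_component[of i] by (simp cong: distr_cong)
  have sets: "sets gauss_seq = sets (Pi\<^sub>M UNIV (\<lambda>_::nat. borel :: real measure))"
    unfolding gauss_seq_def by (intro sets_PiM_cong) auto
  have "indep_vars (\<lambda>_. borel) (\<lambda>i \<omega>. \<omega> i) UNIV"
    by (subst indep_vars_iff_distr_eq_PiM)
       (simp_all add: * gauss_seq_def[symmetric] sets distr_id2 restrict_UNIV)
  from indep_vars_compose2[OF this, of "\<lambda>_. f" "\<lambda>_. borel"] show ?thesis
    by simp
qed

lemma distr_gauss_seq_component_comp:
  fixes f :: "real \<Rightarrow> real"
  assumes [measurable]: "f \<in> borel_measurable borel"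
  shows "distr gauss_seq borel (\<lambda>\<omega>. f (\<omega> i)) = distr std_normal_distribution borel f"
  by (subst distr_gauss_seq_component[of i, symmetric], subst distr_distr)
     (auto simp: comp_def)

lemma gauss_seq_component_integral:
  fixes f :: "real \<Rightarrow> real"
  assumes "has_bochner_integral std_normal_distribution f I"
  shows "has_bochner_integral gauss_seq (\<lambda>\<omega>. f (\<omega> i)) I"
proof -
  have "has_bochner_integral (distr gauss_seq std_normal_distribution (\<lambda>\<omega>. \<omega> i)) f I"
    unfolding distr_gauss_seq_component by (rule assms)
  then show ?thesis
    using assms by (auto simp: has_bochner_integral_iff integral_distr dest: integrable_distr[rotated])
qed

lemma std_normal_integral_one: "has_bochner_integral std_normal_distribution (\<lambda>_. 1) (1 :: real)"
proof -
  interpret real_distribution std_normal_distribution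
    by (rule real_dist_normal_dist)
  show ?thesis
    using prob_space by (simp add: has_bochner_integral_iff)
qed

lemma std_normal_moments:
  "has_bochner_integral std_normal_distribution (\<lambda>x. \<bar>x\<bar>) (sqrt (2 / pi))"
  "has_bochner_integral std_normal_distribution (\<lambda>x. x\<^sup>2) 1"
  "has_bochner_integral std_normal_distribution (\<lambda>x. \<bar>x\<bar> ^ 3) (2 * sqrt (2 / pi))"
  "has_bochner_integral std_normal_distribution (\<lambda>x. x ^ 4) 3"
  using std_normal_moment_abs_odd[of 0] std_normal_moment_even[of 1]
    std_normal_moment_abs_odd[of 1] std_normal_moment_even[of 2]
  by (auto intro!: has_bochner_integral_density simp: fact_numeral mult.commute)

section \<open>When a line meets a ball around a vertex of the cube\<close>

text \<open>
  The squared distance of a vertex \<open>v\<close> from the line spanned by \<open>y\<close> is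
  \<open>\<parallel>v\<parallel>\<^sup>2 - (y \<bullet> v)\<^sup>2 / \<parallel>y\<parallel>\<^sup>2\<close>, and \<open>\<parallel>v\<parallel>\<^sup>2 = n\<close> for all vertices. The nearest vertex is the
  one that copies the signs of \<open>y\<close>, for which \<open>y \<bullet> v\<close> is the sum of the \<open>\<bar>y i\<bar>\<close>. For \<open>y = 0\<close> the
  line is the origin and division by zero gives the correct squared distance \<open>n\<close>.
\<close>

lemma line_hits_cube_ball_iff:
  assumes "r \<ge> 0"
  shows "(\<exists>v\<in>cube_vertices n. line_Rn n y \<inter> ball_Rn n v r \<noteq> {}) \<longleftrightarrow>
    real n - (\<Sum>i<n. \<bar>y i\<bar>)\<^sup>2 / (\<Sum>i<n. (y i)\<^sup>2) \<le> r\<^sup>2"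
proof -
  define S where "S = (\<Sum>i<n. (y i)\<^sup>2)"
  define b where "b v = (\<Sum>i<n. y i * v i)" for v
  define w where "w = (\<lambda>i\<in>{..<n}. if y i \<ge> 0 then 1 else -1 :: real)"
  have S0: "S \<ge> 0"
    unfolding S_def by (simp add: sum_nonneg)
  have hit: "line_Rn n y \<inter> ball_Rn n v r \<noteq> {} \<longleftrightarrow> real n - (b v)\<^sup>2 / S \<le> r\<^sup>2"
    if v: "v \<in> cube_vertices n" for v
  proof -
    define u where "u = b v / S"
    have "v i = 1 \<or> v i = -1" if "i < n" for i
      using v that unfolding cube_vertices_def by (auto dest!: PiE_mem)
    then have sq: "(v i)\<^sup>2 = 1" if "i < n" for i
      using that by fastforce
    have "(\<Sum>i<n. (y i * u - v i)\<^sup>2) = (\<Sum>i<n. (y i)\<^sup>2 * u\<^sup>2 - 2 * u * (y i * v i) + 1)"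
      by (intro sum.cong refl) (simp add: power2_diff power_mult_distrib sq)
    also have "\<dots> = S * u\<^sup>2 - 2 * u * b v + real n"
      unfolding S_def b_def by (simp add: sum.distrib sum_subtractf sum_distrib_left sum_distrib_right)
    also have "\<dots> = real n - (b v)\<^sup>2 / S"
      by (cases "S = 0") (simp_all add: u_def power2_eq_square field_simps)
    finally show ?thesis
      using assms unfolding line_hits_ball_iff S_def[symmetric] b_def[symmetric] u_def[symmetric] L2_set_def
      by (metis real_sqrt_le_iff real_sqrt_abs abs_of_nonneg)
  qed
  have w: "w \<in> cube_vertices n"
    unfolding w_def cube_vertices_def by auto
  have bw: "b w = (\<Sum>i<n. \<bar>y i\<bar>)"
    unfolding b_def w_def by (intro sum.cong) auto
  have b_le: "(b v)\<^sup>2 \<le> (b w)\<^sup>2" if v: "v \<in> cube_vertices n" for v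
  proof -
    have "\<bar>v i\<bar> = 1" if "i < n" for i
      using v that unfolding cube_vertices_def by (fastforce dest!: PiE_mem)
    then have "\<bar>b v\<bar> \<le> b w"
      unfolding bw unfolding b_def by (intro order_trans[OF sum_abs] sum_mono) (simp add: abs_mult)
    then show ?thesis
      using abs_le_square_iff by fastforce
  qed
  have "(\<exists>v\<in>cube_vertices n. real n - (b v)\<^sup>2 / S \<le> r\<^sup>2) \<longleftrightarrow> real n - (b w)\<^sup>2 / S \<le> r\<^sup>2"
  proof
    assume "\<exists>v\<in>cube_vertices n. real n - (b v)\<^sup>2 / S \<le> r\<^sup>2"
    then obtain v where v: "v \<in> cube_vertices n" "real n - (b v)\<^sup>2 / S \<le> r\<^sup>2"
      by blast
    have "(b v)\<^sup>2 / S \<le> (b w)\<^sup>2 / S"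
      using b_le[OF v(1)] S0 by (rule divide_right_mono)
    then show "real n - (b w)\<^sup>2 / S \<le> r\<^sup>2"
      using v(2) by linarith
  qed (use w in blast)
  then show ?thesis
    using hit unfolding bw S_def by auto
qed

lemma hit_prob_mono:
  assumes "r \<le> s"
  shows "hit_prob n r \<le> hit_prob n s"
proof -
  interpret prob_space "gauss_vec n"
    by (rule prob_space_gauss_vec)
  have "ball_Rn n v r \<subseteq> ball_Rn n v s" for v
    using assms unfolding ball_Rn_def by auto
  then show ?thesis
    unfolding hit_prob_def by (intro finite_measure_mono hit_event_measurable) blast
qed

lemma hit_prob_eq_gauss_seq:
  assumes "r \<ge> 0"
  shows "hit_prob n r = measure gauss_seq
    {\<omega> \<in> space gauss_seq. real n - (\<Sum>i<n. \<bar>\<omega> i\<bar>)\<^sup>2 / (\<Sum>i<n. (\<omega> i)\<^sup>2) \<le> r\<^sup>2}"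
proof -
  interpret product_prob_space "\<lambda>_::nat. std_normal_distribution" UNIV
    by (rule product_prob_space_std_normal)
  let ?E = "{y \<in> space (gauss_vec n). \<exists>v\<in>cube_vertices n. line_Rn n y \<inter> ball_Rn n v r \<noteq> {}}"
  have distr: "distr gauss_seq (gauss_vec n) (\<lambda>\<omega>. restrict \<omega> {..<n}) = gauss_vec n"
    unfolding gauss_seq_def gauss_vec_def by (rule distr_PiM_restrict_finite) auto
  have meas: "(\<lambda>\<omega>. restrict \<omega> {..<n}) \<in> measurable gauss_seq (gauss_vec n)"
    unfolding gauss_seq_def gauss_vec_def by (rule measurable_restrict_subset) simp
  have "hit_prob n r = measure gauss_seq ((\<lambda>\<omega>. restrict \<omega> {..<n}) -` ?E \<inter> space gauss_seq)"
    unfolding hit_prob_def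
    by (subst (1) distr[symmetric], subst measure_distr[OF meas hit_event_measurable]) simp
  also have "(\<lambda>\<omega>. restrict \<omega> {..<n}) -` ?E \<inter> space gauss_seq =
    {\<omega> \<in> space gauss_seq. real n - (\<Sum>i<n. \<bar>\<omega> i\<bar>)\<^sup>2 / (\<Sum>i<n. (\<omega> i)\<^sup>2) \<le> r\<^sup>2}"
    using measurable_space[OF meas] unfolding line_hits_cube_ball_iff[OF assms] by auto
  finally show ?thesis .
qed

section \<open>Linearisation of the hitting condition\<close>

text \<open>
  With \<open>a = sqrt S\<close> and \<open>b = sqrt m\<close> the gap is \<open>(a - b)\<^sup>2 / 2\<close>, and \<open>(S - m)\<^sup>2\<close> is
  \<open>(a - b)\<^sup>2 (a + b)\<^sup>2 \<ge> (a - b)\<^sup>2 m\<close>. The square root is thus replaced by a function linear in \<open>S\<close>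
  at a cost quadratic in the deviation of \<open>S\<close> from \<open>m\<close>.
\<close>

lemma arith_geo_mean_gap:
  fixes m S :: real
  assumes "m > 0" "S \<ge> 0"
  shows "0 \<le> (m + S) / 2 - sqrt (m * S)" "(m + S) / 2 - sqrt (m * S) \<le> (S - m)\<^sup>2 / (2 * m)"
proof -
  define a b where "a = sqrt S" and "b = sqrt m"
  have ab: "a \<ge> 0" "b > 0" "S = a\<^sup>2" "m = b\<^sup>2"
    using assms by (auto simp: a_def b_def)
  have gap: "(m + S) / 2 - sqrt (m * S) = (a - b)\<^sup>2 / 2"
    using ab by (simp add: real_sqrt_mult power2_eq_square field_simps)
  show "0 \<le> (m + S) / 2 - sqrt (m * S)"
    unfolding gap by simp
  have "(a - b)\<^sup>2 * b\<^sup>2 \<le> (a - b)\<^sup>2 * (a + b)\<^sup>2"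
    using ab by (intro mult_left_mono power_mono) auto
  also have "\<dots> = (S - m)\<^sup>2"
    unfolding ab by (simp add: power2_eq_square algebra_simps)
  finally show "(m + S) / 2 - sqrt (m * S) \<le> (S - m)\<^sup>2 / (2 * m)"
    unfolding gap using ab by (simp add: field_simps)
qed

text \<open>
  In the application \<open>m\<close> is the dimension, \<open>S\<close> and \<open>B\<close> are the sums of the \<open>y i\<^sup>2\<close> and the
  \<open>\<bar>y i\<bar>\<close>, and \<open>c\<close>, \<open>t\<close> are the limit of \<open>l\<close> and the standard deviation of one summand of \<open>c / 2 (S + m) - B\<close>. Two
  things change when \<open>l sqrt (m S)\<close> is replaced by \<open>c (S + m) / 2\<close>: the slope changes from \<open>l\<close> to
  \<open>c\<close>, which shifts the normalised quantity by about \<open>d\<close>, and the geometric mean becomes the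
  arithmetic one. When \<open>d\<close> tends to \<open>z\<close> and \<open>l\<close> stays bounded, the first factor of the bound tends
  to zero as \<open>m\<close> grows, while the second has bounded mean when \<open>S\<close> has mean \<open>m\<close> and variance
  \<open>2 m\<close>.
\<close>

lemma linearisation_error:
  fixes m S B c l t z :: real
  assumes m: "m > 0" and S: "S \<ge> 0" and l: "l \<ge> 0" and t: "t > 0"
  defines "d \<equiv> (c - l) * sqrt m / t"
  shows "\<bar>z + (l * sqrt (m * S) - B) / (sqrt m * t) - (c / 2 * (S + m) - B) / (sqrt m * t)\<bar>
    \<le> (\<bar>z - d\<bar> + (\<bar>d\<bar> / 4 + l / (2 * t)) / sqrt m) * (1 + (S - m)\<^sup>2 / m)"
proof -
  define q where "q = sqrt m"
  have q: "q > 0" "m = q\<^sup>2"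
    using m by (auto simp: q_def)
  \<comment> \<open>The fluctuation of \<open>S\<close> on its natural scale, the square root of the dimension.\<close>
  define D where "D = (S - m) / q"
  have D2: "(S - m)\<^sup>2 / m = D\<^sup>2"
    unfolding D_def by (simp add: q power_divide)
  define G where "G = (m + S) / 2 - sqrt (m * S)"
  have G: "0 \<le> G" "G \<le> D\<^sup>2 / 2"
    using arith_geo_mean_gap[OF m S] unfolding G_def[symmetric] D2[symmetric] by auto
  have SD: "S = q\<^sup>2 + q * D"
    unfolding D_def using q by (simp add: field_simps)
  have sq: "sqrt (m * S) = (m + S) / 2 - G"
    unfolding G_def by simp
  have cl: "c - l = d * t / q"
    unfolding d_def q_def[symmetric] using q t by simp
  have "z + (l * sqrt (m * S) - B) / (sqrt m * t) - (c / 2 * (S + m) - B) / (sqrt m * t)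
      = z - (c - l) * (m + S) / (2 * q * t) - l * G / (q * t)"
    unfolding sq q_def[symmetric] using q t by (simp add: field_simps)
  also have "\<dots> = (z - d) - d * D / (2 * q) - l * G / (q * t)"
    unfolding cl SD q using q(1) t by (simp add: field_simps power2_eq_square)
  finally have eq: "z + (l * sqrt (m * S) - B) / (sqrt m * t) - (c / 2 * (S + m) - B) / (sqrt m * t)
      = (z - d) - d * D / (2 * q) - l * G / (q * t)" .
  have t1: "\<bar>z - d\<bar> \<le> \<bar>z - d\<bar> * (1 + D\<^sup>2)"
    by (simp add: mult_le_cancel_left1)
  \<comment> \<open>Trading \<open>\<bar>D\<bar>\<close> for \<open>D\<^sup>2\<close> makes the second moment of \<open>S\<close> suffice.\<close>
  have "\<bar>D\<bar> \<le> (1 + D\<^sup>2) / 2"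
    using zero_le_power2[of "\<bar>D\<bar> - 1"] by (simp add: power2_eq_square algebra_simps)
  then have "\<bar>d\<bar> * \<bar>D\<bar> / (2 * q) \<le> \<bar>d\<bar> * ((1 + D\<^sup>2) / 2) / (2 * q)"
    using q by (intro divide_right_mono mult_left_mono) auto
  then have t2: "\<bar>d * D / (2 * q)\<bar> \<le> \<bar>d\<bar> / 4 / q * (1 + D\<^sup>2)"
    using q by (simp add: abs_mult field_simps)
  have "l * G / (q * t) \<le> l * ((1 + D\<^sup>2) / 2) / (q * t)"
    using G q t l by (intro divide_right_mono mult_left_mono) auto
  then have t3: "\<bar>l * G / (q * t)\<bar> \<le> l / (2 * t) / q * (1 + D\<^sup>2)"
    using G q t l by (simp add: abs_mult field_simps)
  have "\<bar>(z - d) - d * D / (2 * q) - l * G / (q * t)\<bar>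
      \<le> \<bar>z - d\<bar> * (1 + D\<^sup>2) + \<bar>d\<bar> / 4 / q * (1 + D\<^sup>2) + l / (2 * t) / q * (1 + D\<^sup>2)"
    using t1 t2 t3 by linarith
  also have "\<dots> = (\<bar>z - d\<bar> + (\<bar>d\<bar> / 4 + l / (2 * t)) / q) * (1 + D\<^sup>2)"
    by (simp add: algebra_simps add_divide_distrib)
  finally show ?thesis
    unfolding D2 eq unfolding q_def[symmetric] .
qed

lemma hit_condition_linear:
  fixes m B S r l :: real
  assumes S: "S > 0" and m: "m > 0" and B: "B \<ge> 0" and l: "l \<ge> 0" "l\<^sup>2 * m = m - r\<^sup>2"
  shows "m - B\<^sup>2 / S \<le> r\<^sup>2 \<longleftrightarrow> l * sqrt (m * S) - B \<le> 0"
proof -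
  have "m - B\<^sup>2 / S \<le> r\<^sup>2 \<longleftrightarrow> l\<^sup>2 * m \<le> B\<^sup>2 / S"
    using l by auto
  also have "\<dots> \<longleftrightarrow> (l * sqrt (m * S))\<^sup>2 \<le> B\<^sup>2"
    using S m by (simp add: field_simps power_mult_distrib)
  also have "\<dots> \<longleftrightarrow> l * sqrt (m * S) \<le> B"
    using B l S m by (auto intro: power2_le_imp_le power_mono)
  finally show ?thesis
    by auto
qed

section \<open>The critical radius\<close>

definition critical_radius :: "real \<Rightarrow> nat \<Rightarrow> real" where
  "critical_radius z n = sqrt ((1 - 2 / pi) * real n) + z * sqrt (2 * (pi - 3) / (pi * (pi - 2)))"

text \<open>
  With \<open>B\<close> and \<open>S\<close> the sums of the \<open>\<bar>y i\<bar>\<close> and the \<open>y i\<^sup>2\<close>, the line meets a ball of this radius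
  if and only if \<open>B\<close> is at least the slope times \<open>sqrt (n S)\<close>, as long as \<open>S > 0\<close> and neither
  the radius nor the slope is negative.
\<close>

definition critical_slope :: "real \<Rightarrow> nat \<Rightarrow> real" where
  "critical_slope z n = sqrt ((real n - (critical_radius z n)\<^sup>2) / real n)"

lemma pi_gt_3: "pi > 3"
  using pi_approx(1) by simp

lemma one_minus_two_over_pi_pos: "1 - 2 / pi > 0"
  using pi_gt_3 by (simp add: field_simps)

lemma filterlim_real_sqrt_at_top: "filterlim (\<lambda>n. sqrt (real n)) at_top sequentially"
  by (rule filterlim_compose[OF sqrt_at_top filterlim_real_sequentially])

text \<open>
  The coefficient of \<open>z\<close> in the critical radius is chosen such that its product with
  \<open>sqrt (1 - 2 / pi)\<close> equals \<open>sqrt (2 / pi) sqrt (1 - 3 / pi)\<close>: the mean of the absolute value of a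
  standard normal variable times the standard deviation in the central limit theorem below.
\<close>

lemma critical_slope_radicand:
  assumes "n \<ge> 1"
  shows "(real n - (critical_radius z n)\<^sup>2) / real n
    = 2 / pi - 2 * z * (sqrt (2 / pi) * sqrt (1 - 3 / pi)) / sqrt (real n)
      - z\<^sup>2 * (2 * (pi - 3) / (pi * (pi - 2))) / real n"
proof -
  define k s q where "k = 1 - 2 / pi" and "s = 2 * (pi - 3) / (pi * (pi - 2))" and "q = sqrt (real n)"
  have pos: "k > 0" "s > 0" "q > 0" "real n = q\<^sup>2"
    using pi_gt_3 one_minus_two_over_pi_pos assms by (auto simp: k_def s_def q_def)
  have "k * s = (2 / pi) * (1 - 3 / pi)"
    unfolding k_def s_def using pi_gt_3 by (simp add: field_simps)
  then have ks: "sqrt k * sqrt s = sqrt (2 / pi) * sqrt (1 - 3 / pi)"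
    by (simp add: real_sqrt_mult[symmetric])
  have radius: "critical_radius z n = sqrt k * q + z * sqrt s"
    unfolding critical_radius_def k_def[symmetric] s_def[symmetric] q_def by (simp add: real_sqrt_mult)
  have "(critical_radius z n)\<^sup>2 = (sqrt k)\<^sup>2 * q\<^sup>2 + 2 * z * (sqrt k * sqrt s) * q + z\<^sup>2 * (sqrt s)\<^sup>2"
    unfolding radius by (simp add: power2_eq_square algebra_simps)
  also have "\<dots> = k * q\<^sup>2 + 2 * z * (sqrt k * sqrt s) * q + z\<^sup>2 * s"
    using pos by simp
  finally have "(real n - (critical_radius z n)\<^sup>2) / real n
      = 1 - k - 2 * z * (sqrt k * sqrt s) / q - z\<^sup>2 * s / q\<^sup>2"
    using pos by (simp add: field_simps power2_eq_square)
  then show ?thesis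
    unfolding ks pos(4) using pos(3) by (simp add: k_def s_def)
qed

lemma critical_slope_tendsto: "critical_slope z \<longlonglongrightarrow> sqrt (2 / pi)"
proof -
  have "(\<lambda>n. sqrt (2 / pi - 2 * z * (sqrt (2 / pi) * sqrt (1 - 3 / pi)) / sqrt (real n)
      - z\<^sup>2 * (2 * (pi - 3) / (pi * (pi - 2))) / real n)) \<longlonglongrightarrow> sqrt (2 / pi - 0 - 0)"
    by (intro tendsto_real_sqrt tendsto_diff real_tendsto_divide_at_top[OF tendsto_const]
        tendsto_const filterlim_real_sequentially filterlim_real_sqrt_at_top)
  moreover have "\<forall>\<^sub>F n in sequentially.
      sqrt (2 / pi - 2 * z * (sqrt (2 / pi) * sqrt (1 - 3 / pi)) / sqrt (real n)
        - z\<^sup>2 * (2 * (pi - 3) / (pi * (pi - 2))) / real n) = critical_slope z n"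
    using eventually_ge_at_top[of 1]
    by eventually_elim (simp only: critical_slope_def critical_slope_radicand)
  ultimately show ?thesis
    using Lim_transform_eventually by fastforce
qed

lemma critical_slope_pos: "\<forall>\<^sub>F n in sequentially. critical_slope z n > 0"
  using order_tendstoD(1)[OF critical_slope_tendsto, of 0] by simp

text \<open>
  This is where the normalisation of the critical radius pays off: the slope approaches
  \<open>sqrt (2 / pi)\<close> at exactly the rate that moves the threshold in the central limit theorem to \<open>z\<close>.
  The limit is read off from the difference of the squares, divided by the sum.
\<close>

lemma critical_slope_rate:
  "(\<lambda>n. (sqrt (2 / pi) - critical_slope z n) * sqrt (real n) / sqrt (1 - 3 / pi)) \<longlonglongrightarrow> z"
proof -
  define c t s where "c = sqrt (2 / pi)" and "t = sqrt (1 - 3 / pi)"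
    and "s = 2 * (pi - 3) / (pi * (pi - 2))"
  have pos: "c > 0" "t > 0"
    using pi_gt_3 by (auto simp: c_def t_def)
  have "(\<lambda>n. (2 * z * c * t + z\<^sup>2 * s / sqrt (real n)) / (t * (c + critical_slope z n)))
      \<longlonglongrightarrow> (2 * z * c * t + 0) / (t * (c + c))"
    by (intro tendsto_divide tendsto_add tendsto_mult tendsto_const real_tendsto_divide_at_top[OF tendsto_const]
        filterlim_real_sqrt_at_top critical_slope_tendsto[folded c_def]) (use pos in auto)
  moreover have "(2 * z * c * t + 0) / (t * (c + c)) = z"
    using pos by (simp add: field_simps)
  moreover have "\<forall>\<^sub>F n in sequentially.
      (2 * z * c * t + z\<^sup>2 * s / sqrt (real n)) / (t * (c + critical_slope z n))
      = (c - critical_slope z n) * sqrt (real n) / t"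
    using critical_slope_pos[of z] eventually_ge_at_top[of 1]
  proof eventually_elim
    case (elim n)
    define l q where "l = critical_slope z n" and "q = sqrt (real n)"
    have q: "q > 0" "real n = q\<^sup>2" and l: "l > 0"
      using elim by (auto simp: l_def q_def)
    have "l\<^sup>2 = (real n - (critical_radius z n)\<^sup>2) / real n"
      using l unfolding l_def critical_slope_def by simp
    also have "\<dots> = c\<^sup>2 - 2 * z * (c * t) / q - z\<^sup>2 * s / q\<^sup>2"
      using critical_slope_radicand[OF elim(2), of z] unfolding c_def[symmetric] t_def[symmetric] s_def[symmetric] q_def[symmetric]
      by (simp add: q(2)[symmetric] c_def)
    finally have "(c - l) * (c + l) = 2 * z * (c * t) / q + z\<^sup>2 * s / q\<^sup>2"
      by (simp add: power2_eq_square algebra_simps)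
    then have "(c - l) * (c + l) * q = 2 * z * c * t + z\<^sup>2 * s / q"
      using q(1) by (simp add: field_simps power2_eq_square)
    moreover have "(c - l) * k * q / (t * k) = (c - l) * q / t" if "k > 0" for k
      using that pos by (simp add: field_simps)
    ultimately show ?case
      using pos l unfolding l_def[symmetric] q_def[symmetric] by (metis add_pos_pos)
  qed
  ultimately have "(\<lambda>n. (c - critical_slope z n) * sqrt (real n) / t) \<longlonglongrightarrow> z"
    using Lim_transform_eventually by simp
  then show ?thesis
    unfolding c_def t_def .
qed

text \<open>
  A change of the constant under the square root outweighs any bounded shift of the radius. The two
  non-critical regimes are thereby compared with the critical one for every \<open>z\<close>.
\<close>

lemma eventually_sqrt_add_le_sqrt:
  assumes "a < b"
  shows "\<forall>\<^sub>F n in sequentially. sqrt (a * real n) + K \<le> sqrt (b * real n)"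
proof -
  have gap: "sqrt b - sqrt a > 0"
    using assms by simp
  have "\<forall>\<^sub>F n in sequentially. K / (sqrt b - sqrt a) \<le> sqrt (real n)"
    using filterlim_real_sqrt_at_top unfolding filterlim_at_top by blast
  then show ?thesis
    by eventually_elim (use gap in \<open>simp add: real_sqrt_mult divide_le_eq algebra_simps\<close>)
qed

lemma eventually_sqrt_le_critical_radius:
  assumes "\<alpha> < 1 - 2 / pi"
  shows "\<forall>\<^sub>F n in sequentially. sqrt (\<alpha> * real n) \<le> critical_radius z n"
  using eventually_sqrt_add_le_sqrt[OF assms, of "- z * sqrt (2 * (pi - 3) / (pi * (pi - 2)))"]
  by eventually_elim (simp add: critical_radius_def)

lemma eventually_critical_radius_le_sqrt:
  assumes "\<alpha> > 1 - 2 / pi"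
  shows "\<forall>\<^sub>F n in sequentially. critical_radius z n \<le> sqrt (\<alpha> * real n)"
  using eventually_sqrt_add_le_sqrt[OF assms, of "z * sqrt (2 * (pi - 3) / (pi * (pi - 2)))"]
  unfolding critical_radius_def .

section \<open>Limit theorems for the Gaussian sums\<close>

text \<open>
  The linearised statistic is a sum of independent copies of \<open>c / 2 (Y\<^sup>2 + 1) - \<bar>Y\<bar>\<close>. As \<open>\<bar>Y\<bar>\<close>
  has mean \<open>c\<close> and \<open>\<bar>Y\<bar>\<^sup>3\<close> has mean \<open>2 c\<close>, such a copy is centred with variance
  \<open>1 - 3 / 2 c\<^sup>2 = 1 - 3 / pi\<close>.
\<close>

lemma gauss_seq_contrast_clt:
  defines "c \<equiv> sqrt (2 / pi)" and "t \<equiv> sqrt (1 - 3 / pi)"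
  shows "weak_conv_m (\<lambda>n. distr gauss_seq borel
      (\<lambda>\<omega>. (c / 2 * ((\<Sum>i<n. (\<omega> i)\<^sup>2) + real n) - (\<Sum>i<n. \<bar>\<omega> i\<bar>)) / (sqrt (real n) * t)))
    std_normal_distribution"
proof -
  interpret prob_space gauss_seq
    by (rule prob_space_gauss_seq)
  define f where "f x = c / 2 * (x\<^sup>2 + 1) - \<bar>x\<bar>" for x :: real
  have [measurable]: "f \<in> borel_measurable borel"
    unfolding f_def by measurable
  have c: "c\<^sup>2 = 2 / pi" and t: "t > 0" "t\<^sup>2 = 1 - 3 / pi"
    using pi_gt_3 by (auto simp: c_def t_def)
  note moments = std_normal_moments[folded c_def]
  have "has_bochner_integral std_normal_distribution (\<lambda>x. c / 2 * (x\<^sup>2 + 1) - \<bar>x\<bar>) (c / 2 * (1 + 1) - c)"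
    by (intro has_bochner_integral_diff has_bochner_integral_mult_right has_bochner_integral_add moments std_normal_integral_one)
  then have mean: "has_bochner_integral std_normal_distribution f 0"
    unfolding f_def by simp
  have "has_bochner_integral std_normal_distribution
      (\<lambda>x. c\<^sup>2 / 4 * (x ^ 4 + 2 * x\<^sup>2 + 1) + x\<^sup>2 - c * (\<bar>x\<bar> ^ 3 + \<bar>x\<bar>))
      (c\<^sup>2 / 4 * (3 + 2 * 1 + 1) + 1 - c * (2 * c + c))"
    by (intro has_bochner_integral_diff has_bochner_integral_mult_right has_bochner_integral_add moments std_normal_integral_one)
  also have "(\<lambda>x. c\<^sup>2 / 4 * (x ^ 4 + 2 * x\<^sup>2 + 1) + x\<^sup>2 - c * (\<bar>x\<bar> ^ 3 + \<bar>x\<bar>)) = (\<lambda>x. (f x)\<^sup>2)"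
    unfolding f_def by (auto simp: fun_eq_iff abs_if power2_eq_square power3_eq_cube power4_eq_xxxx algebra_simps)
  \<comment> \<open>The moments give \<open>1 - 3 / 2 c\<^sup>2\<close>, and \<open>c\<^sup>2 = 2 / pi\<close>.\<close>
  also have "c\<^sup>2 / 4 * (3 + 2 * 1 + 1) + 1 - c * (2 * c + c) = t\<^sup>2"
    using c t by (simp add: power2_eq_square algebra_simps)
  finally have sq: "has_bochner_integral std_normal_distribution (\<lambda>x. (f x)\<^sup>2) (t\<^sup>2)" .
  have comp: "expectation (\<lambda>\<omega>. f (\<omega> i)) = 0" "integrable gauss_seq (\<lambda>\<omega>. (f (\<omega> i))\<^sup>2)"
      "expectation (\<lambda>\<omega>. (f (\<omega> i))\<^sup>2) = t\<^sup>2" for i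
    using gauss_seq_component_integral[OF mean, of i] gauss_seq_component_integral[OF sq, of i]
    by (auto simp: has_bochner_integral_iff)
  have "weak_conv_m (\<lambda>n. distr gauss_seq borel (\<lambda>\<omega>. (\<Sum>i<n. f (\<omega> i)) / sqrt (real n * t\<^sup>2)))
      std_normal_distribution"
    by (rule central_limit_theorem_zero_mean[where \<mu> = "distr std_normal_distribution borel f"])
       (use comp t in \<open>auto intro!: indep_vars_gauss_seq distr_gauss_seq_component_comp\<close>)
  moreover have "(\<Sum>i<n. f (\<omega> i)) = c / 2 * ((\<Sum>i<n. (\<omega> i)\<^sup>2) + real n) - (\<Sum>i<n. \<bar>\<omega> i\<bar>)" for n \<omega>
    unfolding f_def sum_subtractf sum_distrib_left[symmetric] by (simp add: sum.distrib)
  moreover have "sqrt (real n * t\<^sup>2) = sqrt (real n) * t" for n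
    using t(1) by (simp add: real_sqrt_mult)
  ultimately show ?thesis
    by simp
qed

lemma gauss_seq_sum_squares_variance:
  "integrable gauss_seq (\<lambda>\<omega>. ((\<Sum>i<n. (\<omega> i)\<^sup>2) - real n)\<^sup>2)"
  "(\<integral>\<omega>. ((\<Sum>i<n. (\<omega> i)\<^sup>2) - real n)\<^sup>2 \<partial>gauss_seq) = 2 * real n"
proof -
  interpret prob_space gauss_seq
    by (rule prob_space_gauss_seq)
  have mean: "has_bochner_integral std_normal_distribution (\<lambda>x. x\<^sup>2 - 1) (1 - 1)"
    by (intro has_bochner_integral_diff std_normal_moments std_normal_integral_one)
  have "has_bochner_integral std_normal_distribution (\<lambda>x. x ^ 4 - 2 * x\<^sup>2 + 1) (3 - 2 * 1 + 1)"
    by (intro has_bochner_integral_diff has_bochner_integral_mult_right has_bochner_integral_add std_normal_moments std_normal_integral_one)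
  also have "(\<lambda>x::real. x ^ 4 - 2 * x\<^sup>2 + 1) = (\<lambda>x. (x\<^sup>2 - 1)\<^sup>2)"
    by (auto simp: fun_eq_iff power2_eq_square power4_eq_xxxx algebra_simps)
  finally have sq: "has_bochner_integral std_normal_distribution (\<lambda>x. (x\<^sup>2 - 1)\<^sup>2) 2"
    by simp
  have "indep_vars (\<lambda>_. borel) (\<lambda>i \<omega>. (\<omega> i)\<^sup>2 - 1) UNIV"
    by (rule indep_vars_gauss_seq) measurable
  then have "integrable gauss_seq (\<lambda>\<omega>. (\<Sum>i<n. (\<omega> i)\<^sup>2 - 1)\<^sup>2)
      \<and> expectation (\<lambda>\<omega>. (\<Sum>i<n. (\<omega> i)\<^sup>2 - 1)\<^sup>2) = real n * 2"
    by (rule second_moment_sum_indep)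
       (use gauss_seq_component_integral[OF mean] gauss_seq_component_integral[OF sq]
         in \<open>auto simp: has_bochner_integral_iff\<close>)
  then show "integrable gauss_seq (\<lambda>\<omega>. ((\<Sum>i<n. (\<omega> i)\<^sup>2) - real n)\<^sup>2)"
    "expectation (\<lambda>\<omega>. ((\<Sum>i<n. (\<omega> i)\<^sup>2) - real n)\<^sup>2) = 2 * real n"
    by (simp_all add: sum_subtractf)
qed

lemma AE_gauss_seq_sum_squares_pos:
  assumes "n \<ge> 1"
  shows "AE \<omega> in gauss_seq. (\<Sum>i<n. (\<omega> i)\<^sup>2) > 0"
proof -
  have "AE x in std_normal_distribution. x \<noteq> 0"
    by (subst AE_density) (auto intro: AE_mp[OF AE_lborel_singleton])
  then have "AE \<omega> in gauss_seq. \<omega> 0 \<noteq> 0"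
    unfolding gauss_seq_def
    by (intro AE_PiM_component) (auto intro: real_distribution.axioms(1) real_dist_normal_dist)
  then show ?thesis
  proof (rule AE_mp, intro AE_I2 impI)
    fix \<omega> :: "nat \<Rightarrow> real"
    assume "\<omega> 0 \<noteq> 0"
    then show "(\<Sum>i<n. (\<omega> i)\<^sup>2) > 0"
      using assms by (intro sum_pos2[where i = 0]) auto
  qed
qed

section \<open>The phase transition\<close>

text \<open>
  For large \<open>n\<close> and up to a null set, the line meets a ball if and only if the normalised statistic
  \<open>X n\<close> of the central limit theorem, perturbed by the linearisation error \<open>R n\<close>, is at most \<open>z\<close>.
\<close>

theorem hit_prob_critical_radius_tendsto:
  "(\<lambda>n. hit_prob n (critical_radius z n)) \<longlonglongrightarrow> cdf std_normal_distribution z"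
proof -
  interpret prob_space gauss_seq
    by (rule prob_space_gauss_seq)
  define c t where "c = sqrt (2 / pi)" and "t = sqrt (1 - 3 / pi)"
  define l d where "l n = critical_slope z n" and "d n = (c - l n) * sqrt (real n) / t" for n
  define B S where "B n \<omega> = (\<Sum>i<n. \<bar>\<omega> i\<bar>)" and "S n \<omega> = (\<Sum>i<n. (\<omega> i)\<^sup>2)"
    for n and \<omega> :: "nat \<Rightarrow> real"
  have [measurable]: "B n \<in> borel_measurable gauss_seq" "S n \<in> borel_measurable gauss_seq" for n
    unfolding B_def S_def by measurable
  have B0: "B n \<omega> \<ge> 0" and S0: "S n \<omega> \<ge> 0" for n \<omega>
    unfolding B_def S_def by (auto intro: sum_nonneg)
  have t: "t > 0"
    using pi_gt_3 by (simp add: t_def)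
  define X where "X n \<omega> = (c / 2 * (S n \<omega> + real n) - B n \<omega>) / (sqrt (real n) * t)" for n \<omega>
  \<comment> \<open>The perturbation is the exact difference, so that \<open>X n + R n \<le> z\<close> means exactly
    \<open>l n sqrt (n S) \<le> B\<close>.\<close>
  define R where "R n \<omega> = z + (l n * sqrt (real n * S n \<omega>) - B n \<omega>) / (sqrt (real n) * t) - X n \<omega>" for n \<omega>
  define Q where "Q n \<omega> = (S n \<omega> - real n)\<^sup>2 / real n" for n \<omega>
  \<comment> \<open>The absolute value of the slope keeps \<open>\<delta>\<close> nonnegative also for small \<open>n\<close>, where the radicand
    of the slope may be negative.\<close>
  define \<delta> where "\<delta> n = \<bar>z - d n\<bar> + (\<bar>d n\<bar> / 4 + \<bar>l n\<bar> / (2 * t)) / sqrt (real n)" for n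
  have [measurable]: "X n \<in> borel_measurable gauss_seq" "R n \<in> borel_measurable gauss_seq" for n
    unfolding R_def X_def by measurable
  have \<delta>: "\<delta> \<longlonglongrightarrow> 0"
  proof -
    have d: "d \<longlonglongrightarrow> z" and l: "l \<longlonglongrightarrow> c"
      using critical_slope_rate[of z] critical_slope_tendsto[of z]
      unfolding d_def l_def c_def t_def by auto
    have "(\<lambda>n. \<bar>z - d n\<bar> + (\<bar>d n\<bar> / 4 + \<bar>l n\<bar> / (2 * t)) / sqrt (real n)) \<longlonglongrightarrow> \<bar>z - z\<bar> + 0"
      by (intro tendsto_add tendsto_rabs tendsto_diff tendsto_const d l
          real_tendsto_divide_at_top[where c = "\<bar>z\<bar> / 4 + \<bar>c\<bar> / (2 * t)"] tendsto_divide filterlim_real_sqrt_at_top)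
         (use t in auto)
    then show ?thesis
      unfolding \<delta>_def by simp
  qed
  have \<delta>0: "\<delta> n \<ge> 0" for n
    unfolding \<delta>_def using t by simp
  have "\<forall>\<^sub>F n in sequentially. l n > 0"
    using critical_slope_pos unfolding l_def .
  moreover have "\<forall>\<^sub>F n in sequentially. n \<ge> 1"
    by (rule eventually_ge_at_top)
  ultimately have "\<forall>\<^sub>F n in sequentially. \<forall>\<omega>. \<bar>R n \<omega>\<bar> \<le> \<delta> n * (1 + Q n \<omega>)"
  proof eventually_elim
    case (elim n)
    show ?case
      using linearisation_error[of "real n" "S n \<omega>" "l n" t z B c for \<omega> B, OF _ S0 _ t] elim
      unfolding R_def X_def \<delta>_def Q_def d_def by simp
  qed
  then have negl: "(\<lambda>n. prob {\<omega> \<in> space gauss_seq. e \<le> \<bar>R n \<omega>\<bar>}) \<longlonglongrightarrow> 0" if "e > 0" for e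
    by (intro tendsto_prob_dominated_zero[where Q = Q and K = 2 and \<delta> = \<delta>] \<delta> \<delta>0 that)
       (use gauss_seq_sum_squares_variance in \<open>auto simp: Q_def[abs_def] S_def divide_le_eq\<close>)
  have "(\<lambda>n. prob {\<omega> \<in> space gauss_seq. X n \<omega> + R n \<omega> \<le> z}) \<longlonglongrightarrow> cdf std_normal_distribution z"
    using gauss_seq_contrast_clt
    by (intro tendsto_prob_add_negligible isCont_cdf_std_normal negl)
       (auto simp: X_def[abs_def] B_def S_def c_def t_def)
  moreover have "\<forall>\<^sub>F n in sequentially.
      prob {\<omega> \<in> space gauss_seq. X n \<omega> + R n \<omega> \<le> z} = hit_prob n (critical_radius z n)"
    using critical_slope_pos[of z] eventually_ge_at_top[of 1]
      eventually_sqrt_le_critical_radius[OF one_minus_two_over_pi_pos, of z]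
  proof eventually_elim
    case (elim n)
    have r0: "critical_radius z n \<ge> 0"
      using elim by simp
    have l: "l n \<ge> 0" "(l n)\<^sup>2 * real n = real n - (critical_radius z n)\<^sup>2"
      using elim by (auto simp: l_def critical_slope_def)
    have "X n \<omega> + R n \<omega> \<le> z \<longleftrightarrow> l n * sqrt (real n * S n \<omega>) - B n \<omega> \<le> 0" for \<omega>
      unfolding R_def using elim t by (simp add: divide_le_0_iff mult_le_0_iff)
    then have iff: "X n \<omega> + R n \<omega> \<le> z \<longleftrightarrow> real n - (B n \<omega>)\<^sup>2 / S n \<omega> \<le> (critical_radius z n)\<^sup>2"
      if "S n \<omega> > 0" for \<omega>
      using hit_condition_linear[OF that _ B0 l] elim by simp
    show ?case
      unfolding hit_prob_eq_gauss_seq[OF r0] B_def[symmetric] S_def[symmetric]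
      by (rule prob_eq_AE)
         (use AE_gauss_seq_sum_squares_pos[OF elim(2)] iff in \<open>auto simp: S_def[symmetric] elim!: AE_mp\<close>)
  qed
  ultimately show ?thesis
    by (rule Lim_transform_eventually)
qed

theorem corollary2:
  fixes r :: "nat \<Rightarrow> real"
  assumes r_nonneg: "\<And>n. n \<ge> 1 \<Longrightarrow> r n \<ge> 0"
  shows "(\<forall>\<alpha>::real. \<alpha> < 1 - 2 / pi \<longrightarrow> (\<forall>n\<ge>1. r n \<le> sqrt (\<alpha> * real n)) \<longrightarrow>
            (\<lambda>n. hit_prob n (r n)) \<longlonglongrightarrow> 0) \<and>
         (\<forall>\<alpha>::real. \<alpha> > 1 - 2 / pi \<longrightarrow> (\<forall>n\<ge>1. r n \<ge> sqrt (\<alpha> * real n)) \<longrightarrow>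
            (\<lambda>n. hit_prob n (r n)) \<longlonglongrightarrow> 1) \<and>
         (\<forall>z::real. (\<forall>n\<ge>1.
              sqrt ((1 - 2 / pi) * real n) + z * sqrt (2 * (pi - 3) / (pi * (pi - 2))) \<ge> 0 \<longrightarrow>
              r n = sqrt ((1 - 2 / pi) * real n) + z * sqrt (2 * (pi - 3) / (pi * (pi - 2)))) \<longrightarrow>
            (\<lambda>n. hit_prob n (r n)) \<longlonglongrightarrow> cdf std_normal_distribution z)"
proof (intro conjI allI impI)
  interpret real_distribution std_normal_distribution
    by (rule real_dist_normal_dist)
  have nonneg: "hit_prob n s \<ge> 0" and le_1: "hit_prob n s \<le> 1" for n s
    unfolding hit_prob_def by (simp_all add: prob_space.prob_le_1[OF prob_space_gauss_vec])
  {
    fix \<alpha> :: real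
    assume \<alpha>: "\<alpha> < 1 - 2 / pi" and r: "\<forall>n\<ge>1. r n \<le> sqrt (\<alpha> * real n)"
    show "(\<lambda>n. hit_prob n (r n)) \<longlonglongrightarrow> 0"
    proof (rule order_tendstoI)
      fix e :: real
      assume "e > 0"
      \<comment> \<open>The radius is eventually below every critical radius, also for very negative \<open>z\<close>.\<close>
      then obtain z where z: "cdf std_normal_distribution z < e"
        using eventually_happens[OF order_tendstoD(2)[OF cdf_lim_at_bot]] by fastforce
      have "\<forall>\<^sub>F n in sequentially. hit_prob n (critical_radius z n) < e"
        by (rule order_tendstoD(2)[OF hit_prob_critical_radius_tendsto z])
      then show "\<forall>\<^sub>F n in sequentially. hit_prob n (r n) < e"
        using eventually_sqrt_le_critical_radius[OF \<alpha>, of z] eventually_ge_at_top[of 1]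
      proof eventually_elim
        case (elim n)
        have "hit_prob n (r n) \<le> hit_prob n (critical_radius z n)"
          using r elim by (intro hit_prob_mono) (auto intro: order_trans)
        then show ?case
          using elim by linarith
      qed
    qed (use less_le_trans[OF _ nonneg] in \<open>auto intro!: always_eventually\<close>)
  next
    fix \<alpha> :: real
    assume \<alpha>: "\<alpha> > 1 - 2 / pi" and r: "\<forall>n\<ge>1. r n \<ge> sqrt (\<alpha> * real n)"
    show "(\<lambda>n. hit_prob n (r n)) \<longlonglongrightarrow> 1"
    proof (rule order_tendstoI)
      fix e :: real
      assume "e < 1"
      \<comment> \<open>The radius is eventually above every critical radius, also for very large \<open>z\<close>.\<close>
      then obtain z where z: "e < cdf std_normal_distribution z"
        using eventually_happens[OF order_tendstoD(1)[OF cdf_lim_at_top_prob]] by fastforce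
      have "\<forall>\<^sub>F n in sequentially. e < hit_prob n (critical_radius z n)"
        by (rule order_tendstoD(1)[OF hit_prob_critical_radius_tendsto z])
      then show "\<forall>\<^sub>F n in sequentially. e < hit_prob n (r n)"
        using eventually_critical_radius_le_sqrt[OF \<alpha>, of z] eventually_ge_at_top[of 1]
      proof eventually_elim
        case (elim n)
        have "hit_prob n (critical_radius z n) \<le> hit_prob n (r n)"
          using r elim by (intro hit_prob_mono) (auto intro: order_trans)
        then show ?case
          using elim by linarith
      qed
    qed (use le_less_trans[OF le_1] in \<open>auto intro!: always_eventually\<close>)
  next
    fix z :: real
    assume r: "\<forall>n\<ge>1. sqrt ((1 - 2 / pi) * real n) + z * sqrt (2 * (pi - 3) / (pi * (pi - 2))) \<ge> 0 \<longrightarrow>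
        r n = sqrt ((1 - 2 / pi) * real n) + z * sqrt (2 * (pi - 3) / (pi * (pi - 2)))"
    have "\<forall>\<^sub>F n in sequentially. hit_prob n (critical_radius z n) = hit_prob n (r n)"
      using eventually_sqrt_le_critical_radius[OF one_minus_two_over_pi_pos, of z]
        eventually_ge_at_top[of 1]
    proof eventually_elim
      case (elim n)
      then have "r n = critical_radius z n"
        using r unfolding critical_radius_def by simp
      then show ?case
        by simp
    qed
    then show "(\<lambda>n. hit_prob n (r n)) \<longlonglongrightarrow> cdf std_normal_distribution z"
      by (rule Lim_transform_eventually[OF hit_prob_critical_radius_tendsto])
  }
qed

end
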